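(* Let $\kappa$ be a regular infinite cardinal and $\mu$ a singular cardinal with $\mathrm{cf}(\mu)=\kappa$. Then $\mathrm{cov}(\mathcal M_\kappa({}^{\mu}2,\kappa))=\mathrm{cov}(\mathcal M_\kappa({}^{\mu}\kappa,\kappa))$, $\mathrm{add}(\mathcal M_\kappa({}^{\mu}2,\kappa))=\mathrm{add}(\mathcal M_\kappa({}^{\mu}\kappa,\kappa))$, $\mathrm{non}(\mathcal M_\kappa({}^{\mu}2,\kappa))=\mathrm{non}(\mathcal M_\kappa({}^{\mu}\kappa,\kappa))$, and $\mathrm{cof}(\mathcal M_\kappa({}^{\mu}2,\kappa))=\mathrm{cof}(\mathcal M_\kappa({}^{\mu}\kappa,\kappa))$.
   Context: For ordinals $\delta,\rho$, ${}^{\delta}\rho$ is the set of functions $\delta\to\rho$; for a partial function $s\colon\delta\rightharpoonup\rho$, $[s]=\{f\in{}^{\delta}\rho: s\subseteq f\}$. The ${<}\kappa$-box topology on ${}^{\delta}\rho$ has base $\{[s]: |\mathrm{dom}(s)|<\kappa\}$; $(X,\kappa)$ denotes $X$ with it. A set is $\kappa$-meagre if it is a union of at most $\kappa$ nowhere dense sets; $\mathcal M_\kappa(X,\tau)$ is the ideal of $\kappa$-meagre subsets of $(X,\tau)$. For a proper ideal $\mathcal I$ on $X$: $\mathrm{add}(\mathcal I)$ = least size of $A\subseteq\mathcal I$ with $\bigcup A\notin\mathcal I$; $\mathrm{cov}(\mathcal I)$ = least size of $C\subseteq\mathcal I$ with $\bigcup C=X$; $\mathrm{non}(\mathcal I)$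 = least size of $N\subseteq X$ with $N\notin\mathcal I$; $\mathrm{cof}(\mathcal I)$ = least size of $F\subseteq\mathcal I$ such that every $I\in\mathcal I$ is contained in some $J\in F$. *)

theory Defs
  imports "HOL-Analysis.Analysis" "HOL-Library.FuncSet"
begin

unbundle cardinal_syntax

text \<open>Cardinals are represented as cardinal-order relations (Card_order) of Main;
  the ordinal \<open>\<delta>\<close> is represented by the set Field of such a relation.
  The function space \<open>\<delta>\<rho>\<close> is the set of extensional functions M ->E B (Pi_E).\<close>

definition basic_open :: "'m set \<Rightarrow> 'b set \<Rightarrow> ('m \<rightharpoonup> 'b) \<Rightarrow> ('m \<Rightarrow> 'b) set" where
  "basic_open M B s = {f \<in> M \<rightarrow>\<^sub>E B. \<forall>x\<in>dom s. s x = Some (f x)}"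

definition box_base :: "'m set \<Rightarrow> 'b set \<Rightarrow> 'k rel \<Rightarrow> ('m \<Rightarrow> 'b) set set" where
  "box_base M B k = {basic_open M B s | s. dom s \<subseteq> M \<and> ran s \<subseteq> B \<and> |dom s| <o k}"

definition box_topology :: "'m set \<Rightarrow> 'b set \<Rightarrow> 'k rel \<Rightarrow> ('m \<Rightarrow> 'b) topology" where
  "box_topology M B k = topology_generated_by (box_base M B k)"

definition nowhere_dense_in :: "'a topology \<Rightarrow> 'a set \<Rightarrow> bool" where
  "nowhere_dense_in T A \<longleftrightarrow> A \<subseteq> topspace T \<and> T interior_of (T closure_of A) = {}"

definition meagre_ideal :: "'a topology \<Rightarrow> 'k rel \<Rightarrow> 'a set set" where
  "meagre_ideal T k = {\<Union>F | F. |F| \<le>o k \<and> (\<forall>N\<in>F. nowhere_dense_in T N)}"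

definition add_witness :: "'a set set \<Rightarrow> 'a set set \<Rightarrow> bool" where
  "add_witness I A \<longleftrightarrow> A \<subseteq> I \<and> \<Union>A \<notin> I"

definition cov_witness :: "'a set \<Rightarrow> 'a set set \<Rightarrow> 'a set set \<Rightarrow> bool" where
  "cov_witness X I C \<longleftrightarrow> C \<subseteq> I \<and> \<Union>C = X"

definition non_witness :: "'a set \<Rightarrow> 'a set set \<Rightarrow> 'a set \<Rightarrow> bool" where
  "non_witness X I N \<longleftrightarrow> N \<subseteq> X \<and> N \<notin> I"

definition cof_witness :: "'a set set \<Rightarrow> 'a set set \<Rightarrow> bool" where
  "cof_witness I F \<longleftrightarrow> F \<subseteq> I \<and> (\<forall>A\<in>I. \<exists>J\<in>F. A \<subseteq> J)"

text \<open>The least size of a P-witness equals the least size of a Q-witness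
  (cardinals are well-ordered, so this is equivalent to mutual domination).\<close>
definition same_least_size :: "('a set \<Rightarrow> bool) \<Rightarrow> ('b set \<Rightarrow> bool) \<Rightarrow> bool" where
  "same_least_size P Q \<longleftrightarrow>
     (\<forall>A. P A \<longrightarrow> (\<exists>B. Q B \<and> |B| \<le>o |A| )) \<and>
     (\<forall>B. Q B \<longrightarrow> (\<exists>A. P A \<and> |A| \<le>o |B| ))"

end

theory Submission
  imports Defs
begin

text \<open>
  Call \<open>A \<subseteq> Y\<close> reflected by a map \<open>\<phi> : X \<rightarrow> Y\<close> if \<open>A\<close> is meagre in \<open>Y\<close> exactly when its preimage is
  meagre in \<open>X\<close>.  If all sets are reflected, preimages and images transport witnesses and give
  cov(X) \<open>\<le>\<close> cov(Y), add(X) \<open>\<le>\<close> add(Y), non(Y) \<open>\<le>\<close> non(X), cof(Y) \<open>\<le>\<close> cof(X).  Such maps exist in both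
  directions: from \<open>\<kappa>\<close>-valued to 0-1-valued sequences, test each coordinate for equality with a fixed
  ordinal; conversely split the \<open>\<mu>\<close> coordinates into \<open>\<mu>\<close> rows of length \<open>\<kappa>\<close> and read in each row the
  position of the first 1.  Both compute each output coordinate from a row of input coordinates, in
  such a way that a small condition can always be extended to decide any
  fewer than \<open>\<kappa>\<close> outputs, and an untouched row can be made to decide any prescribed value.  Hence preimages of
  nowhere dense sets are nowhere dense, even though the second map is not continuous (a row may be
  constantly 0).  For the converse, given \<open>\<kappa>\<close> many nowhere dense sets covering the preimage of \<open>A\<close>, a
  tree of height \<open>\<kappa>\<close> of conditions is built whose levels are maximal antichains as seen from \<open>Y\<close>; a
  point of \<open>Y\<close> that meets every level determines a branch, and the branch yields a preimage of that
  point outside all the nowhere dense sets.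
\<close>

section \<open>Box topologies and small conditions\<close>

definition conds :: "'m set \<Rightarrow> 'b set \<Rightarrow> 'k rel \<Rightarrow> ('m \<rightharpoonup> 'b) set" where
  "conds M B k = {s. dom s \<subseteq> M \<and> ran s \<subseteq> B \<and> |dom s| <o k}"

lemma basic_open_iff:
  "f \<in> basic_open M B s \<longleftrightarrow> f \<in> M \<rightarrow>\<^sub>E B \<and> (\<forall>a b. s a = Some b \<longrightarrow> f a = b)"
  unfolding basic_open_def by force

lemma map_le_iff: "s \<subseteq>\<^sub>m s' \<longleftrightarrow> (\<forall>a b. s a = Some b \<longrightarrow> s' a = Some b)"
  unfolding map_le_def by force

lemma basic_open_antimono: "s \<subseteq>\<^sub>m s' \<Longrightarrow> basic_open M B s' \<subseteq> basic_open M B s"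
  by (auto simp: basic_open_iff map_le_iff)

lemma basic_open_nonempty:
  assumes "dom s \<subseteq> M" "ran s \<subseteq> B" "B \<noteq> {}"
  obtains f where "f \<in> basic_open M B s"
proof -
  obtain b where "b \<in> B" using assms by auto
  define f where "f = (\<lambda>a\<in>M. case s a of None \<Rightarrow> b | Some c \<Rightarrow> c)"
  have "f \<in> basic_open M B s"
    using assms \<open>b \<in> B\<close> unfolding f_def basic_open_iff
    by (auto split: option.splits intro: subsetD[OF \<open>ran s \<subseteq> B\<close>, OF ranI])
  then show ?thesis using that by blast
qed

lemma conds_basic_open_nonempty:
  assumes "s \<in> conds M B k" "B \<noteq> {}"
  shows "\<exists>f. f \<in> basic_open M B s"
proof -
  have "dom s \<subseteq> M" "ran s \<subseteq> B" using assms(1) unfolding conds_def by auto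
  then show ?thesis using basic_open_nonempty[OF _ _ assms(2)] by metis
qed

lemma basic_open_union:
  assumes "f \<in> basic_open M B s" "f \<in> basic_open M B t"
  shows "s \<subseteq>\<^sub>m s ++ t" "t \<subseteq>\<^sub>m s ++ t" "f \<in> basic_open M B (s ++ t)"
  using assms unfolding basic_open_iff map_le_iff
  by (fastforce simp: map_add_def split: option.splits)+

text \<open>Pairwise agreement makes the union of the graphs single-valued. The family may have any
  size, unlike with iterated \<open>++\<close>.\<close>

lemma coherent_union:
  assumes "\<And>p q a b c. p \<in> F \<Longrightarrow> q \<in> F \<Longrightarrow> p a = Some b \<Longrightarrow> q a = Some c \<Longrightarrow> b = c"
  obtains u :: "'a \<rightharpoonup> 'b" where "\<And>a b. u a = Some b \<longleftrightarrow> (\<exists>p\<in>F. p a = Some b)"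
proof
  fix a b
  let ?u = "\<lambda>a. if \<exists>p\<in>F. \<exists>b. p a = Some b then Some (SOME b. \<exists>p\<in>F. p a = Some b) else None"
  have *: "(SOME b. \<exists>p\<in>F. p a = Some b) = b" if "p \<in> F" "p a = Some b" for p b
    by (rule some_equality) (use that in blast, use that assms in metis)
  show "?u a = Some b \<longleftrightarrow> (\<exists>p\<in>F. p a = Some b)"
    using * by (auto split: if_splits)
qed

text \<open>Cutting every piece of a cover down to \<open>A'\<close> keeps it nowhere dense, since
  closure and interior are monotone.\<close>

lemma meagre_ideal_subset:
  assumes "A \<in> meagre_ideal T k" "A' \<subseteq> A"
  shows "A' \<in> meagre_ideal T k"
proof -
  obtain F where F: "A = \<Union>F" "|F| \<le>o k" "\<forall>N\<in>F. nowhere_dense_in T N"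
    using assms(1) unfolding meagre_ideal_def by auto
  have "nowhere_dense_in T (N \<inter> A')" if "nowhere_dense_in T N" for N
  proof -
    have "T interior_of (T closure_of (N \<inter> A')) \<subseteq> T interior_of (T closure_of N)"
      by (intro interior_of_mono closure_of_mono) auto
    then show ?thesis using that unfolding nowhere_dense_in_def by auto
  qed
  moreover have "|(\<lambda>N. N \<inter> A') ` F| \<le>o k"
    using card_of_image F(2) ordLeq_transitive by blast
  moreover have "A' = \<Union>((\<lambda>N. N \<inter> A') ` F)" using F(1) assms(2) by auto
  ultimately show ?thesis using F(3) unfolding meagre_ideal_def by blast
qed

section \<open>Sets and conditions smaller than a regular cardinal\<close>

locale regular_cardinal =
  fixes k :: "'k rel"
  assumes card: "Card_order k" and inf: "Cinfinite k" and reg: "regularCard k"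
begin

lemma infinite_k: "\<not> finite (Field k)"
  using inf unfolding cinfinite_def by blast

lemma stable_k: "stable k"
  using regularCard_stable[OF card infinite_k reg] .

lemma small_Un: "|A| <o k \<Longrightarrow> |A'| <o k \<Longrightarrow> |A \<union> A'| <o k"
  using card_of_Un_ordLess_infinite_Field[OF infinite_k card] by blast

text \<open>Regularity of \<open>k\<close> enters here. Through \<open>conds_Union\<close> it makes
  the union of a coherent family of fewer than \<open>k\<close> conditions a condition
  again.\<close>

lemma small_UN: "|A| <o k \<Longrightarrow> (\<And>a. a \<in> A \<Longrightarrow> |F a| <o k) \<Longrightarrow> |\<Union>a\<in>A. F a| <o k"
  using stable_UNION[OF stable_k] by blast

lemma small_finite: "finite A \<Longrightarrow> |A| <o k"
  using finite_ordLess_infinite[OF card_of_Well_order card_order_on_well_order_on[OF card]]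
    infinite_k by (simp add: Field_card_of)

lemma small_subset: "|A| <o k \<Longrightarrow> A' \<subseteq> A \<Longrightarrow> |A'| <o k"
  using card_of_mono1 ordLeq_ordLess_trans by blast

lemma small_image: "|A| <o k \<Longrightarrow> |f ` A| <o k"
  using card_of_image ordLeq_ordLess_trans by blast

text \<open>Proper initial segments of a cardinal are smaller than it, so each step of a recursion
  along \<open>k\<close> has only a small family of earlier conditions to unite.\<close>

lemma small_underS: "|underS k i| <o k"
proof (cases "i \<in> Field k")
  case True
  then show ?thesis using card_of_underS[OF card] by blast
next
  case False
  then have "underS k i = {}" unfolding underS_def Field_def by auto
  then show ?thesis by (simp add: small_finite)
qed

lemma condsI: "dom s \<subseteq> M \<Longrightarrow> ran s \<subseteq> B \<Longrightarrow> |dom s| <o k \<Longrightarrow> s \<in> conds M B k"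
  unfolding conds_def by simp

lemma conds_empty: "Map.empty \<in> conds M B k"
  by (simp add: conds_def small_finite)

lemma conds_add: "s \<in> conds M B k \<Longrightarrow> t \<in> conds M B k \<Longrightarrow> s ++ t \<in> conds M B k"
  unfolding conds_def by (auto simp: small_Un ran_def)

lemma conds_Union:
  assumes "|F| <o k" "F \<subseteq> conds M B k" "\<And>a b. u a = Some b \<longleftrightarrow> (\<exists>p\<in>F. p a = Some b)"
  shows "u \<in> conds M B k"
proof (rule condsI)
  have d: "dom u = (\<Union>p\<in>F. dom p)" using assms(3) by (auto simp: dom_def)
  show "dom u \<subseteq> M" "|dom u| <o k"
    using assms(1,2) unfolding d conds_def by (auto intro!: small_UN)
  show "ran u \<subseteq> B" using assms(2,3) unfolding conds_def ran_def by blast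
qed

section \<open>The box topology expressed through conditions\<close>

lemma openin_box:
  assumes "s \<in> conds M B k"
  shows "openin (box_topology M B k) (basic_open M B s)"
  using assms unfolding box_topology_def box_base_def conds_def
  by (intro topology_generated_by_Basis) blast

lemma topspace_box: "topspace (box_topology M B k) = M \<rightarrow>\<^sub>E B"
proof -
  have "basic_open M B Map.empty \<in> box_base M B k"
    unfolding box_base_def using conds_empty[of M B] by (force simp: conds_def)
  moreover have "basic_open M B Map.empty = M \<rightarrow>\<^sub>E B" "\<And>s. basic_open M B s \<subseteq> M \<rightarrow>\<^sub>E B"
    unfolding basic_open_def by auto
  ultimately show ?thesis unfolding box_topology_def topology_generated_by_topspace box_base_def
    by blast
qed

text \<open>The generated topology also closes the base under finite intersections; these add
  nothing, since around a common point \<open>f\<close> the sets given by \<open>s\<close> and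
  \<open>t\<close> contain the one given by \<open>s ++ t\<close>.\<close>

lemma openin_box_basic:
  assumes "openin (box_topology M B k) U" "f \<in> U"
  obtains s where "s \<in> conds M B k" "f \<in> basic_open M B s" "basic_open M B s \<subseteq> U"
proof -
  have "generate_topology_on (box_base M B k) U"
    using assms(1) unfolding box_topology_def by (rule openin_topology_generated_by)
  then have "\<forall>f\<in>U. \<exists>s\<in>conds M B k. f \<in> basic_open M B s \<and> basic_open M B s \<subseteq> U"
  proof induction
    case Empty
    then show ?case by simp
  next
    case (Int a b)
    show ?case
    proof
      fix f assume f: "f \<in> a \<inter> b"
      obtain s where s: "s \<in> conds M B k" "f \<in> basic_open M B s" "basic_open M B s \<subseteq> a"
        using Int f by blast
      obtain t where t: "t \<in> conds M B k" "f \<in> basic_open M B t" "basic_open M B t \<subseteq> b"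
        using Int f by blast
      note st = basic_open_union[OF s(2) t(2)]
      show "\<exists>s\<in>conds M B k. f \<in> basic_open M B s \<and> basic_open M B s \<subseteq> a \<inter> b"
        using st s t conds_add[OF s(1) t(1)] basic_open_antimono[OF st(1), of M B]
          basic_open_antimono[OF st(2), of M B] by blast
    qed
  next
    case (UN K)
    then show ?case by (meson Union_iff Union_upper subset_trans)
  next
    case (Basis s)
    then show ?case unfolding box_base_def conds_def by blast
  qed
  then show ?thesis using assms(2) that by blast
qed

text \<open>Turns nowhere density into a statement about extending conditions. With
  \<open>B \<noteq> {}\<close> every condition describes a nonempty open set, which cannot lie
  inside the closure of a nowhere dense set.\<close>

lemma nowhere_dense_box_iff:
  assumes "B \<noteq> {}"
  shows "nowhere_dense_in (box_topology M B k) N \<longleftrightarrow> N \<subseteq> M \<rightarrow>\<^sub>E B \<and>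
    (\<forall>s\<in>conds M B k. \<exists>s'\<in>conds M B k. s \<subseteq>\<^sub>m s' \<and> basic_open M B s' \<inter> N = {})"
    (is "nowhere_dense_in ?T N \<longleftrightarrow> _")
proof (intro iffI conjI ballI)
  assume nd: "nowhere_dense_in ?T N"
  show "N \<subseteq> M \<rightarrow>\<^sub>E B" using nd unfolding nowhere_dense_in_def topspace_box by simp
  fix s assume s: "s \<in> conds M B k"
  obtain f0 where "f0 \<in> basic_open M B s"
    using conds_basic_open_nonempty[OF s assms] by blast
  then have "\<not> basic_open M B s \<subseteq> ?T closure_of N"
    using nd interior_of_maximal[OF _ openin_box[OF s]] unfolding nowhere_dense_in_def by blast
  then obtain f where f: "f \<in> basic_open M B s" "f \<notin> ?T closure_of N" by blast
  have "f \<in> topspace ?T" using f(1) unfolding topspace_box basic_open_def by simp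
  then obtain U where U: "openin ?T U" "f \<in> U" "U \<inter> N = {}"
    using f(2) unfolding in_closure_of by blast
  obtain t where t: "t \<in> conds M B k" "f \<in> basic_open M B t" "basic_open M B t \<subseteq> U"
    using openin_box_basic[OF U(1,2)] .
  note st = basic_open_union[OF f(1) t(2)]
  show "\<exists>s'\<in>conds M B k. s \<subseteq>\<^sub>m s' \<and> basic_open M B s' \<inter> N = {}"
    using conds_add[OF s t(1)] st(1) basic_open_antimono[OF st(2), of M B] t(3) U(3) by blast
next
  assume *: "N \<subseteq> M \<rightarrow>\<^sub>E B \<and>
    (\<forall>s\<in>conds M B k. \<exists>s'\<in>conds M B k. s \<subseteq>\<^sub>m s' \<and> basic_open M B s' \<inter> N = {})"
  have "False" if f: "f \<in> ?T interior_of (?T closure_of N)" for f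
  proof -
    obtain s where s: "s \<in> conds M B k"
      "basic_open M B s \<subseteq> ?T interior_of (?T closure_of N)"
      using openin_box_basic[OF openin_interior_of f] by metis
    obtain s' where s': "s' \<in> conds M B k" "s \<subseteq>\<^sub>m s'" "basic_open M B s' \<inter> N = {}"
      using * s(1) by blast
    obtain g where g: "g \<in> basic_open M B s'"
      using conds_basic_open_nonempty[OF s'(1) assms] by blast
    have "g \<in> ?T closure_of N"
      using g s(2) basic_open_antimono[OF s'(2), of M B] interior_of_subset by fast
    then show False using g s'(3) openin_box[OF s'(1)] unfolding in_closure_of by blast
  qed
  then show "nowhere_dense_in ?T N"
    using * unfolding nowhere_dense_in_def topspace_box by blast
qed


section \<open>Distributivity of small conditions\<close>

lemma wo_rel_k: "wo_rel k"
  using card_order_on_well_order_on[OF card] unfolding wo_rel_def .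

lemma underS_subset: "underS k i \<subseteq> Field k"
  unfolding underS_def Field_def by auto

lemma underS_total:
  assumes "i \<in> Field k" "j \<in> Field k"
  shows "i = j \<or> i \<in> underS k j \<or> j \<in> underS k i"
  using wo_rel.TOTAL[OF wo_rel_k] assms unfolding total_on_def underS_def by blast

lemma wf_k: "wf (k - Id)"
  using wo_rel.WF[OF wo_rel_k] .

lemma in_k_minus_Id: "(l, j) \<in> k - Id \<longleftrightarrow> l \<in> underS k j"
  unfolding underS_def by auto

text \<open>An increasing sequence along \<open>k\<close> starts above \<open>s\<close> and enters
  \<open>E j\<close> at step \<open>j\<close>; at each step the earlier values form a small chain
  whose union is again a condition. Step \<open>i\<close> lies above all earlier ones, hence in
  every \<open>E j\<close> by upward closure.\<close>

lemma conds_distributive: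
  assumes s: "s \<in> conds M B k"
    and dense: "\<And>j p. j \<in> underS k i \<Longrightarrow> p \<in> conds M B k \<Longrightarrow>
                  \<exists>q\<in>conds M B k. p \<subseteq>\<^sub>m q \<and> q \<in> E j"
    and upward: "\<And>j p q. p \<in> E j \<Longrightarrow> p \<subseteq>\<^sub>m q \<Longrightarrow> q \<in> E j"
  shows "\<exists>q\<in>conds M B k. s \<subseteq>\<^sub>m q \<and> (\<forall>j\<in>underS k i. q \<in> E j)"
proof -
  \<comment> \<open>Admissible values at \<open>j\<close>, given the earlier ones. Membership in
    \<open>E j\<close> is demanded only below \<open>i\<close>, so that the recursion can run over
    the whole type and \<open>f i\<close> is itself one of its values.\<close>
  define P where "P f j r \<longleftrightarrow> r \<in> conds M B k \<and> s \<subseteq>\<^sub>m r \<and>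
    (\<forall>l\<in>underS k j. f l \<subseteq>\<^sub>m r) \<and> (j \<in> underS k i \<longrightarrow> r \<in> E j)" for f j r
  have "\<exists>f. \<forall>j. P f j (f j)"
  proof (rule dependent_wf_choice[OF wf_k])
    show "P f x r = P g x r" if "\<And>z. (z, x) \<in> k - Id \<Longrightarrow> f z = g z" for f g x r
      using that unfolding P_def in_k_minus_Id by auto
  next
    fix x f
    assume *: "\<And>y. (y, x) \<in> k - Id \<Longrightarrow> P f y (f y)"
    let ?F = "insert s (f ` underS k x)"
    have coh: "b = c" if pq: "p \<in> ?F" "q \<in> ?F" and v: "p a = Some b" "q a = Some c" for p q a b c
    proof -
      have le: "s \<subseteq>\<^sub>m f l" if "l \<in> underS k x" for l
        using *[unfolded in_k_minus_Id, OF that] unfolding P_def by simp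
      have le': "f l \<subseteq>\<^sub>m f l'" if "l \<in> underS k l'" "l' \<in> underS k x" for l l'
        using *[unfolded in_k_minus_Id, OF that(2)] that unfolding P_def by simp
      have lin: "f l \<subseteq>\<^sub>m f l' \<or> f l' \<subseteq>\<^sub>m f l" if "l \<in> underS k x" "l' \<in> underS k x" for l l'
        using le'[of l l'] le'[of l' l] that underS_total[OF subsetD[OF underS_subset] subsetD[OF underS_subset], OF that] by auto
      have "p \<subseteq>\<^sub>m q \<or> q \<subseteq>\<^sub>m p"
        using pq le lin map_le_refl[of s] by fast
      then show ?thesis using v unfolding map_le_iff by auto
    qed
    obtain u where u: "\<And>a b. u a = Some b \<longleftrightarrow> (\<exists>p\<in>?F. p a = Some b)"
      using coherent_union[of ?F] coh by blast
    have "|?F| <o k"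
      using small_Un[OF small_finite[of "{s}"] small_image[OF small_underS, of f x]] by simp
    moreover have "?F \<subseteq> conds M B k"
      using * s unfolding in_k_minus_Id P_def by auto
    ultimately have uc: "u \<in> conds M B k" using conds_Union u by blast
    have "s \<subseteq>\<^sub>m u" "\<forall>l\<in>underS k x. f l \<subseteq>\<^sub>m u" using u unfolding map_le_iff by auto
    moreover obtain r where "r \<in> conds M B k" "u \<subseteq>\<^sub>m r" "x \<in> underS k i \<longrightarrow> r \<in> E x"
      using uc dense[OF _ uc, of x] map_le_refl[of u] by blast
    ultimately have "P f x r"
      unfolding P_def using map_le_trans by fast
    then show "\<exists>r. P f x r" by blast
  qed
  then obtain f where f: "\<And>j. P f j (f j)" by blast
  have "f i \<in> E j" if "j \<in> underS k i" for j
    using f[of i] f[of j] that upward unfolding P_def by blast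
  then show ?thesis using f[of i] unfolding P_def by blast
qed

end

section \<open>Compatibility and maximal antichains\<close>

definition compat :: "('a \<rightharpoonup> 'b) \<Rightarrow> ('a \<rightharpoonup> 'b) \<Rightarrow> bool" where
  "compat s s' \<longleftrightarrow> (\<forall>a b c. s a = Some b \<longrightarrow> s' a = Some c \<longrightarrow> b = c)"

lemma compat_sym: "compat s s' \<Longrightarrow> compat s' s"
  unfolding compat_def by metis

lemma compat_refl: "compat s s"
  unfolding compat_def by simp

lemma compat_map_le: "s \<subseteq>\<^sub>m u \<Longrightarrow> s' \<subseteq>\<^sub>m u \<Longrightarrow> compat s s'"
  unfolding compat_def map_le_iff by force

lemma compat_mono: "compat s s' \<Longrightarrow> t \<subseteq>\<^sub>m s \<Longrightarrow> compat t s'"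
  unfolding compat_def map_le_iff by blast

lemma compat_add: "compat s s' \<Longrightarrow> s \<subseteq>\<^sub>m s ++ s' \<and> s' \<subseteq>\<^sub>m s ++ s'"
  unfolding compat_def map_le_iff map_add_def by (force split: option.splits)

text \<open>Zorn's lemma applies because independence constrains only two elements at a time and so
  survives unions of chains. With \<open>R\<close> read as compatibility, \<open>W\<close> is a
  maximal antichain.\<close>

lemma maximal_independent_set:
  assumes "symp R" "reflp R"
  shows "\<exists>W\<subseteq>D. (\<forall>v\<in>W. \<forall>w\<in>W. R v w \<longrightarrow> v = w) \<and> (\<forall>d\<in>D. \<exists>w\<in>W. R d w)"
proof -
  define indep where "indep W \<longleftrightarrow> (\<forall>v w. v \<in> W \<longrightarrow> w \<in> W \<longrightarrow> R v w \<longrightarrow> v = w)" for W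
  have indepD: "v = w" if "indep W" "v \<in> W" "w \<in> W" "R v w" for W v w
    using that unfolding indep_def by simp
  let ?A = "{W. W \<subseteq> D \<and> indep W}"
  have "\<exists>W\<in>?A. \<forall>X\<in>?A. W \<subseteq> X \<longrightarrow> X = W"
  proof (rule subset_Zorn')
    fix c assume "subset.chain ?A c"
    then have c: "c \<subseteq> ?A" "\<And>X Y. X \<in> c \<Longrightarrow> Y \<in> c \<Longrightarrow> X \<subseteq> Y \<or> Y \<subseteq> X"
      unfolding subset_chain_def by auto
    have "v = w" if vw: "v \<in> \<Union>c" "w \<in> \<Union>c" "R v w" for v w
    proof -
      obtain X Y where XY: "X \<in> c" "v \<in> X" "Y \<in> c" "w \<in> Y" using vw(1,2) by (elim UnionE)
      have "indep X" "indep Y" using c(1) XY by auto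
      then show ?thesis using c(2)[OF XY(1,3)] XY vw(3) indepD by (elim disjE) auto
    qed
    then have "indep (\<Union>c)" unfolding indep_def by simp
    then show "\<Union>c \<in> ?A" using c(1) by auto
  qed
  then obtain W where W: "W \<subseteq> D" "indep W" "\<And>X. X \<subseteq> D \<Longrightarrow> indep X \<Longrightarrow> W \<subseteq> X \<Longrightarrow> X = W"
    by auto
  have "\<exists>w\<in>W. R d w" if "d \<in> D" for d
  proof (rule ccontr)
    assume n: "\<not> (\<exists>w\<in>W. R d w)"
    have n': "\<not> R d w" "\<not> R w d" if "w \<in> W" for w
      using that n sympD[OF assms(1), of w d] by auto
    have "indep (insert d W)"
      unfolding indep_def using indepD[OF W(2)] n' by simp
    then have "insert d W = W" using W(1) that by (intro W(3)) auto
    then show False using n reflpD[OF assms(2), of d] by auto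
  qed
  moreover have "\<forall>v\<in>W. \<forall>w\<in>W. R v w \<longrightarrow> v = w" using indepD[OF W(2)] by simp
  ultimately show ?thesis using W(1) by (intro exI[of _ W]) simp
qed

section \<open>Maps computed row by row\<close>

text \<open>\<open>\<rho>\<close> assigns input coordinates to rows.  That \<open>\<phi> x \<alpha>\<close> depends on row \<open>\<alpha>\<close> only is not
  assumed; it is enough that values can be decided by conditions inside the row.\<close>

locale row_map = regular_cardinal k for k :: "'k rel" +
  fixes I :: "'i set" and B :: "'b set" and J :: "'j set" and C :: "'c set"
    and \<phi> :: "('i \<Rightarrow> 'b) \<Rightarrow> 'j \<Rightarrow> 'c" and \<rho> :: "'i \<Rightarrow> 'j"
  assumes B_ne: "B \<noteq> {}" and C_ne: "C \<noteq> {}"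
    and map_into: "\<And>x. x \<in> I \<rightarrow>\<^sub>E B \<Longrightarrow> \<phi> x \<in> J \<rightarrow>\<^sub>E C"
    and row: "\<And>i. i \<in> I \<Longrightarrow> \<rho> i \<in> J"
    and decide_row: "\<And>\<alpha> t. \<alpha> \<in> J \<Longrightarrow> t \<in> conds I B k \<Longrightarrow>
      \<exists>t'\<in>conds I B k. \<exists>c\<in>C. t \<subseteq>\<^sub>m t' \<and> (\<forall>i\<in>dom t' - dom t. \<rho> i = \<alpha>) \<and>
        (\<forall>x\<in>basic_open I B t'. \<phi> x \<alpha> = c)"
    and realise_row: "\<And>\<alpha> c. \<alpha> \<in> J \<Longrightarrow> c \<in> C \<Longrightarrow>
      \<exists>p\<in>conds I B k. (\<forall>i\<in>dom p. \<rho> i = \<alpha>) \<and> (\<forall>x\<in>basic_open I B p. \<phi> x \<alpha> = c)"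
begin

text \<open>The clause on \<open>\<rho>\<close> keeps rows whose output \<open>s\<close> leaves open
  untouched by \<open>t\<close>; \<open>forces_lift\<close> exploits this freedom. Neither map has
  to be small, so branches of full length and total functions are covered as well.\<close>

definition forces :: "('i \<rightharpoonup> 'b) \<Rightarrow> ('j \<rightharpoonup> 'c) \<Rightarrow> bool" where
  "forces t s \<longleftrightarrow> dom t \<subseteq> I \<and> ran t \<subseteq> B \<and> dom s \<subseteq> J \<and> ran s \<subseteq> C \<and> \<rho> ` dom t \<subseteq> dom s \<and>
     \<phi> ` basic_open I B t \<subseteq> basic_open J C s"

lemma forces_empty: "forces Map.empty Map.empty"
  unfolding forces_def using map_into by (auto simp: basic_open_iff)

lemma forces_Union:
  assumes F: "\<And>p. p \<in> F \<Longrightarrow> forces (fst p) (snd p)" and "F \<noteq> {}"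
    and u: "\<And>a b. u a = Some b \<longleftrightarrow> (\<exists>p\<in>F. fst p a = Some b)"
    and v: "\<And>a b. v a = Some b \<longleftrightarrow> (\<exists>p\<in>F. snd p a = Some b)"
  shows "forces u v"
proof -
  have d: "dom u = (\<Union>p\<in>F. dom (fst p))" "dom v = (\<Union>p\<in>F. dom (snd p))"
    "ran u = (\<Union>p\<in>F. ran (fst p))" "ran v = (\<Union>p\<in>F. ran (snd p))"
    using u v by (auto simp: dom_def ran_def)
  have "\<phi> x \<in> basic_open J C v" if x: "x \<in> basic_open I B u" for x
  proof -
    have "\<phi> x \<in> basic_open J C (snd p)" if "p \<in> F" for p
    proof -
      have "x \<in> basic_open I B (fst p)" using x that u unfolding basic_open_iff by blast
      then show ?thesis using F[OF that] unfolding forces_def by blast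
    qed
    then show ?thesis using \<open>F \<noteq> {}\<close> v by (auto simp: basic_open_iff)
  qed
  then have "\<phi> ` basic_open I B u \<subseteq> basic_open J C v" by blast
  moreover have "\<rho> ` dom (fst p) \<subseteq> dom (snd p)" if "p \<in> F" for p
    using F[OF that] unfolding forces_def by simp
  then have "\<rho> ` dom u \<subseteq> dom v" unfolding d by blast
  moreover note \<open>\<phi> ` basic_open I B u \<subseteq> basic_open J C v\<close>
  moreover have "dom (fst p) \<subseteq> I \<and> ran (fst p) \<subseteq> B \<and> dom (snd p) \<subseteq> J \<and> ran (snd p) \<subseteq> C"
    if "p \<in> F" for p using F[OF that] unfolding forces_def by simp
  ultimately show ?thesis
    unfolding forces_def d by (simp add: UN_subset_iff)
qed

text \<open>Each relevant row is decided by adding coordinates of that row only, so the separate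
  extensions agree and their union decides all these rows at once. Fewer than \<open>k\<close> rows
  are involved, so the union stays small.\<close>

lemma forces_extend:
  assumes f0: "forces t0 s0" "s0 \<in> conds J C k" and t: "t \<in> conds I B k" "t0 \<subseteq>\<^sub>m t"
  obtains t' s' where "t' \<in> conds I B k" "s' \<in> conds J C k" "t \<subseteq>\<^sub>m t'" "s0 \<subseteq>\<^sub>m s'" "forces t' s'"
proof -
  \<comment> \<open>Rows touched by \<open>t\<close> must be decided for the \<open>\<rho>\<close>
    clause of \<open>forces\<close>; rows in \<open>dom s0\<close> are included so that the new
    output condition extends \<open>s0\<close>.\<close>
  define A where "A = \<rho> ` dom t \<union> dom s0"
  have AJ: "A \<subseteq> J" using row t(1) f0(2) unfolding conds_def A_def by auto
  have A: "|A| <o k"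
    using small_Un[OF small_image] t(1) f0(2) unfolding conds_def A_def by auto
  have "\<forall>\<alpha>\<in>A. \<exists>q. fst q \<in> conds I B k \<and> snd q \<in> C \<and> t \<subseteq>\<^sub>m fst q \<and>
      (\<forall>i\<in>dom (fst q) - dom t. \<rho> i = \<alpha>) \<and> (\<forall>x\<in>basic_open I B (fst q). \<phi> x \<alpha> = snd q)"
    using decide_row[OF _ t(1)] AJ by fastforce
  then obtain Q where Q: "\<forall>\<alpha>\<in>A. fst (Q \<alpha>) \<in> conds I B k \<and> snd (Q \<alpha>) \<in> C \<and> t \<subseteq>\<^sub>m fst (Q \<alpha>) \<and>
      (\<forall>i\<in>dom (fst (Q \<alpha>)) - dom t. \<rho> i = \<alpha>) \<and> (\<forall>x\<in>basic_open I B (fst (Q \<alpha>)). \<phi> x \<alpha> = snd (Q \<alpha>))"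
    by (rule bchoice[THEN exE])
  define T c where "T \<alpha> = fst (Q \<alpha>)" and "c \<alpha> = snd (Q \<alpha>)" for \<alpha>
  have Tc: "T \<alpha> \<in> conds I B k \<and> c \<alpha> \<in> C \<and> t \<subseteq>\<^sub>m T \<alpha> \<and>
      (\<forall>i\<in>dom (T \<alpha>) - dom t. \<rho> i = \<alpha>) \<and> (\<forall>x\<in>basic_open I B (T \<alpha>). \<phi> x \<alpha> = c \<alpha>)" if "\<alpha> \<in> A" for \<alpha>
    using bspec[OF Q that] unfolding T_def c_def by simp
  let ?F = "insert t (T ` A)"
  have coh: "b = b'" if pq: "p \<in> ?F" "q \<in> ?F" "p a = Some b" "q a = Some b'" for p q a b b'
  proof (cases "t a")
    case None
    have "p = T (\<rho> a)" if p: "p \<in> ?F" "p a = Some b" for p b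
    proof -
      obtain \<alpha> where \<alpha>: "\<alpha> \<in> A" "p = T \<alpha>" using p None by auto
      then have "a \<in> dom (T \<alpha>) - dom t" using p None by (auto simp: domIff)
      then have "\<rho> a = \<alpha>" using Tc[OF \<alpha>(1)] by blast
      then show ?thesis using \<alpha>(2) by simp
    qed
    then have "p = T (\<rho> a)" "q = T (\<rho> a)" using pq by blast+
    then show ?thesis using pq by auto
  next
    case (Some d)
    have "p a = Some d" if "p \<in> ?F" for p
    proof -
      have "t \<subseteq>\<^sub>m p" using that Tc map_le_refl[of t] by blast
      then show ?thesis using Some unfolding map_le_iff by simp
    qed
    then have "p a = Some d" "q a = Some d" using pq by blast+
    then show ?thesis using pq by auto
  qed
  obtain u where u: "\<And>a b. u a = Some b \<longleftrightarrow> (\<exists>p\<in>?F. p a = Some b)"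
    using coherent_union[of ?F] coh by blast
  have "|?F| <o k"
    using small_Un[OF small_finite[of "{t}"] small_image[OF A, of T]] by simp
  moreover have "?F \<subseteq> conds I B k" using Tc t(1) by auto
  ultimately have uc: "u \<in> conds I B k" using conds_Union u by blast
  have tu: "t \<subseteq>\<^sub>m u" "\<And>\<alpha>. \<alpha> \<in> A \<Longrightarrow> T \<alpha> \<subseteq>\<^sub>m u" using u unfolding map_le_iff by auto
  define s' where "s' = (\<lambda>\<alpha>. if \<alpha> \<in> A then Some (c \<alpha>) else None)"
  have ds: "dom s' = A" unfolding s'_def by (auto simp: dom_def)
  have rs: "ran s' \<subseteq> C" unfolding s'_def ran_def using Tc by (auto split: if_splits)
  have sc: "s' \<in> conds J C k" using ds rs AJ A by (auto intro: condsI)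
  have du: "\<rho> ` dom u \<subseteq> A"
  proof
    fix \<alpha> assume "\<alpha> \<in> \<rho> ` dom u"
    then obtain a b p where "\<alpha> = \<rho> a" "p \<in> ?F" "p a = Some b" using u by (auto simp: dom_def)
    moreover have "\<rho> a \<in> A" if "a \<notin> dom t"
    proof -
      have "p \<noteq> t" using that calculation by auto
      then obtain \<beta> where \<beta>: "\<beta> \<in> A" "p = T \<beta>" using calculation by blast
      then have "a \<in> dom (T \<beta>) - dom t" using that calculation by (auto simp: domIff)
      then have "\<rho> a = \<beta>" using Tc[OF \<beta>(1)] by blast
      then show ?thesis using \<beta>(1) by simp
    qed
    ultimately show "\<alpha> \<in> A" unfolding A_def by (cases "a \<in> dom t") auto
  qed
  have val: "\<phi> x \<alpha> = c \<alpha>" if "x \<in> basic_open I B u" "\<alpha> \<in> A" for x \<alpha>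
    using Tc[OF that(2)] basic_open_antimono[OF tu(2)[OF that(2)], of I B] that(1) by blast
  have im: "\<phi> ` basic_open I B u \<subseteq> basic_open J C s'"
  proof
    fix y assume "y \<in> \<phi> ` basic_open I B u"
    then obtain x where x: "y = \<phi> x" "x \<in> basic_open I B u" by blast
    then have "\<phi> x \<in> J \<rightarrow>\<^sub>E C" by (intro map_into) (simp add: basic_open_iff)
    then show "y \<in> basic_open J C s'"
      using val[OF x(2)] x(1) by (simp add: basic_open_iff s'_def)
  qed
  have fo: "forces u s'"
    using uc sc du ds im unfolding forces_def conds_def by simp
  \<comment> \<open>A sample point shows that the newly decided values agree with \<open>s0\<close>:
    \<open>\<phi> x\<close> obeys \<open>c\<close> and, since \<open>u\<close> extends
    \<open>t0\<close>, also \<open>s0\<close>.\<close>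
  obtain x where x: "x \<in> basic_open I B u"
    using conds_basic_open_nonempty[OF uc B_ne] by blast
  have "x \<in> basic_open I B t0"
    using x basic_open_antimono[OF map_le_trans[OF t(2) tu(1)]] by blast
  moreover have "\<phi> ` basic_open I B t0 \<subseteq> basic_open J C s0"
    using f0(1) unfolding forces_def by simp
  ultimately have "\<phi> x \<in> basic_open J C s0" by blast
  then have "\<phi> x \<alpha> = b \<and> \<alpha> \<in> A" if "s0 \<alpha> = Some b" for \<alpha> b
    using that by (auto simp: basic_open_iff A_def)
  then have "c \<alpha> = b \<and> \<alpha> \<in> A" if "s0 \<alpha> = Some b" for \<alpha> b
    using that val[OF x, of \<alpha>] by auto
  then have "s0 \<subseteq>\<^sub>m s'"
    by (simp add: map_le_iff s'_def)
  then show ?thesis using that uc sc tu(1) fo by blast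
qed

text \<open>Outputs new in \<open>s'\<close> belong to rows that \<open>t\<close> does not touch, so
  conditions realising them live on coordinates disjoint from \<open>t\<close> and from each other.
  Smallness is a separate conclusion because the lift is also applied to a total
  \<open>s'\<close>.\<close>

lemma forces_lift:
  assumes f: "forces t s" and s': "s \<subseteq>\<^sub>m s'" "dom s' \<subseteq> J" "ran s' \<subseteq> C"
  obtains t' where "t \<subseteq>\<^sub>m t'" "forces t' s'"
    "t \<in> conds I B k \<Longrightarrow> s' \<in> conds J C k \<Longrightarrow> t' \<in> conds I B k"
proof -
  define A where "A = dom s' - dom s"
  have tI: "dom t \<subseteq> I" "ran t \<subseteq> B" "dom s \<subseteq> J" "\<rho> ` dom t \<subseteq> dom s"
    "\<phi> ` basic_open I B t \<subseteq> basic_open J C s" using f unfolding forces_def by auto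
  have sA: "the (s' \<alpha>) \<in> C" "\<alpha> \<in> J" if "\<alpha> \<in> A" for \<alpha>
    using that s'(2,3) by (auto simp: ran_def A_def)
  have "\<forall>\<alpha>\<in>A. \<exists>p. p \<in> conds I B k \<and> (\<forall>i\<in>dom p. \<rho> i = \<alpha>) \<and>
      (\<forall>x\<in>basic_open I B p. \<phi> x \<alpha> = the (s' \<alpha>))"
    using realise_row[OF sA(2) sA(1)] by blast
  then obtain T where T': "\<forall>\<alpha>\<in>A. T \<alpha> \<in> conds I B k \<and> (\<forall>i\<in>dom (T \<alpha>). \<rho> i = \<alpha>) \<and>
      (\<forall>x\<in>basic_open I B (T \<alpha>). \<phi> x \<alpha> = the (s' \<alpha>))"
    by (rule bchoice[THEN exE])
  have T: "T \<alpha> \<in> conds I B k \<and> (\<forall>i\<in>dom (T \<alpha>). \<rho> i = \<alpha>) \<and>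
      (\<forall>x\<in>basic_open I B (T \<alpha>). \<phi> x \<alpha> = the (s' \<alpha>))" if "\<alpha> \<in> A" for \<alpha>
    using bspec[OF T' that] .
  let ?F = "insert t (T ` A)"
  \<comment> \<open>The row of \<open>a\<close> alone determines which member of \<open>?F\<close>
    can be defined at \<open>a\<close>, so distinct members have disjoint domains.\<close>
  have key: "p = (if \<rho> a \<in> dom s then t else T (\<rho> a))" if pa: "p \<in> ?F" "a \<in> dom p" for p a
  proof (cases "p = t")
    case True
    then show ?thesis using tI(4) pa(2) by auto
  next
    case False
    then obtain \<beta> where \<beta>: "\<beta> \<in> A" "p = T \<beta>" using pa(1) by blast
    then have "\<rho> a = \<beta>" using T[OF \<beta>(1)] pa(2) by blast
    then show ?thesis using \<beta> by (simp add: A_def)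
  qed
  have coh: "b = b'" if "p \<in> ?F" "q \<in> ?F" "p a = Some b" "q a = Some b'" for p q a b b'
    using key[OF that(1), of a] key[OF that(2), of a] that(3,4) by (simp add: domIff)
  obtain u where u: "\<And>a b. u a = Some b \<longleftrightarrow> (\<exists>p\<in>?F. p a = Some b)"
    using coherent_union[of ?F] coh by blast
  have tu: "t \<subseteq>\<^sub>m u" "\<And>\<alpha>. \<alpha> \<in> A \<Longrightarrow> T \<alpha> \<subseteq>\<^sub>m u" using u unfolding map_le_iff by auto
  have uc: "u \<in> conds I B k" if "t \<in> conds I B k" "s' \<in> conds J C k"
  proof -
    have "|A| <o k" using that(2) unfolding conds_def A_def by (auto intro: small_subset)
    then have "|?F| <o k"
      using small_Un[OF small_finite[of "{t}"] small_image[of A T]] by simp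
    moreover have "?F \<subseteq> conds I B k" using T that(1) by auto
    ultimately show ?thesis using conds_Union u by blast
  qed
  have du: "dom u = dom t \<union> (\<Union>\<alpha>\<in>A. dom (T \<alpha>))" "ran u = ran t \<union> (\<Union>\<alpha>\<in>A. ran (T \<alpha>))"
    using u by (auto simp: dom_def ran_def)
  have "dom (T \<alpha>) \<subseteq> I \<and> ran (T \<alpha>) \<subseteq> B" if "\<alpha> \<in> A" for \<alpha>
    using T[OF that] unfolding conds_def by simp
  then have uI: "dom u \<subseteq> I" "ran u \<subseteq> B" using tI(1,2) unfolding du by blast+
  have ru: "\<rho> ` dom u \<subseteq> dom s'"
  proof -
    have "\<rho> a \<in> dom s'" if a: "a \<in> dom (T \<alpha>)" "\<alpha> \<in> A" for a \<alpha>
    proof -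
      have "\<rho> a = \<alpha>" using T[OF a(2)] a(1) by blast
      then show ?thesis using a(2) A_def by blast
    qed
    moreover have "\<rho> a \<in> dom s'" if "a \<in> dom t" for a
      using tI(4) map_le_implies_dom_le[OF s'(1)] that by blast
    ultimately show ?thesis unfolding du by blast
  qed
  have im: "\<phi> x \<in> basic_open J C s'" if x: "x \<in> basic_open I B u" for x
  proof -
    have "\<phi> x \<in> basic_open J C s"
      using tI(5) x basic_open_antimono[OF tu(1), of I B] by blast
    moreover have "\<phi> x \<alpha> = the (s' \<alpha>)" if "\<alpha> \<in> A" for \<alpha>
      using T[OF that] x basic_open_antimono[OF tu(2)[OF that], of I B] by blast
    moreover have "s \<alpha> = Some b" if "s' \<alpha> = Some b" "\<alpha> \<in> dom s" for \<alpha> b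
      using s'(1) that unfolding map_le_def by auto
    moreover have "\<phi> x \<alpha> = b" if "s' \<alpha> = Some b" for \<alpha> b
      using calculation that unfolding basic_open_iff by (cases "\<alpha> \<in> dom s") (auto simp: domIff A_def)
    ultimately show ?thesis by (simp add: basic_open_iff)
  qed
  have "forces u s'" using uI s'(2,3) ru im unfolding forces_def by auto
  then show ?thesis using that tu(1) uc by blast
qed

text \<open>Takes the place of continuity: decide the rows touched by \<open>t\<close>, avoid
  \<open>N\<close> on the output side, and lift the resulting output condition back.\<close>

lemma nowhere_dense_vimage:
  assumes "nowhere_dense_in (box_topology J C k) N"
  shows "nowhere_dense_in (box_topology I B k) {x \<in> I \<rightarrow>\<^sub>E B. \<phi> x \<in> N}"
  unfolding nowhere_dense_box_iff[OF B_ne]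
proof (intro conjI ballI)
  fix t assume t: "t \<in> conds I B k"
  obtain t1 s1 where 1: "t1 \<in> conds I B k" "s1 \<in> conds J C k" "t \<subseteq>\<^sub>m t1" "forces t1 s1"
    using forces_extend[OF forces_empty conds_empty t] by auto
  obtain s2 where 2: "s2 \<in> conds J C k" "s1 \<subseteq>\<^sub>m s2" "basic_open J C s2 \<inter> N = {}"
    using assms 1(2) unfolding nowhere_dense_box_iff[OF C_ne] by blast
  have d: "dom s2 \<subseteq> J" "ran s2 \<subseteq> C" using 2(1) unfolding conds_def by auto
  obtain t3 where 3: "t1 \<subseteq>\<^sub>m t3" "forces t3 s2" "t3 \<in> conds I B k"
    using forces_lift[OF 1(4) 2(2) d] 1(1) 2(1) by metis
  have "\<phi> ` basic_open I B t3 \<subseteq> basic_open J C s2"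
    using 3(2) unfolding forces_def by simp
  then have "basic_open I B t3 \<inter> {x \<in> I \<rightarrow>\<^sub>E B. \<phi> x \<in> N} = {}"
    using 2(3) by blast
  then show "\<exists>s'\<in>conds I B k. t \<subseteq>\<^sub>m s' \<and> basic_open I B s' \<inter> {x \<in> I \<rightarrow>\<^sub>E B. \<phi> x \<in> N} = {}"
    using 3 map_le_trans[OF 1(3) 3(1)] by blast
qed auto

lemma meagre_vimage:
  assumes "A \<in> meagre_ideal (box_topology J C k) k"
  shows "{x \<in> I \<rightarrow>\<^sub>E B. \<phi> x \<in> A} \<in> meagre_ideal (box_topology I B k) k"
proof -
  obtain F where F: "A = \<Union>F" "|F| \<le>o k" "\<forall>N\<in>F. nowhere_dense_in (box_topology J C k) N"
    using assms unfolding meagre_ideal_def by auto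
  let ?g = "\<lambda>N. {x \<in> I \<rightarrow>\<^sub>E B. \<phi> x \<in> N}"
  have "|?g ` F| \<le>o k" using card_of_image F(2) ordLeq_transitive by blast
  moreover have "?g A = \<Union>(?g ` F)" using F(1) by auto
  moreover have "\<forall>N\<in>?g ` F. nowhere_dense_in (box_topology I B k) N"
    using F(3) nowhere_dense_vimage by blast
  ultimately show ?thesis unfolding meagre_ideal_def by blast
qed

end

subsection \<open>The tree of maximal antichains\<close>

context row_map
begin

text \<open>Level \<open>i\<close> of the tree consists of pairs in \<open>stage N W i\<close>, which refine some node of every earlier
  level and avoid \<open>N i\<close>.  Antichains refer to the second components only: this is what makes
  the branch through a point of the target space unique.\<close>

definition stage ::
  "('k \<Rightarrow> ('i \<Rightarrow> 'b) set) \<Rightarrow> ('k \<Rightarrow> (('i \<rightharpoonup> 'b) \<times> ('j \<rightharpoonup> 'c)) set) \<Rightarrow> 'k \<Rightarrow> (('i \<rightharpoonup> 'b) \<times> ('j \<rightharpoonup> 'c)) set"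
  where
  "stage N W i = {p. fst p \<in> conds I B k \<and> snd p \<in> conds J C k \<and> forces (fst p) (snd p) \<and>
     basic_open I B (fst p) \<inter> N i = {} \<and>
     (\<forall>j\<in>underS k i. \<exists>w\<in>W j. fst w \<subseteq>\<^sub>m fst p \<and> snd w \<subseteq>\<^sub>m snd p)}"

text \<open>The last two clauses make the second components of \<open>W i\<close> a maximal
  antichain among those of \<open>stage N W i\<close>, with each node determined by its second
  component.\<close>

definition antichain_tree ::
  "('k \<Rightarrow> ('i \<Rightarrow> 'b) set) \<Rightarrow> ('k \<Rightarrow> (('i \<rightharpoonup> 'b) \<times> ('j \<rightharpoonup> 'c)) set) \<Rightarrow> bool" where
  "antichain_tree N W \<longleftrightarrow> (\<forall>i. W i \<subseteq> stage N W i \<and>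
     (\<forall>v\<in>W i. \<forall>w\<in>W i. compat (snd v) (snd w) \<longrightarrow> v = w) \<and>
     (\<forall>p\<in>stage N W i. \<exists>w\<in>W i. compat (snd p) (snd w)))"

lemma antichain_treeD:
  assumes "antichain_tree N W"
  shows "W i \<subseteq> stage N W i"
    and "v \<in> W i \<Longrightarrow> w \<in> W i \<Longrightarrow> compat (snd v) (snd w) \<Longrightarrow> v = w"
    and "p \<in> stage N W i \<Longrightarrow> \<exists>w\<in>W i. compat (snd p) (snd w)"
  using assms unfolding antichain_tree_def by auto

text \<open>\<open>stage N W i\<close> consults \<open>W\<close> only below \<open>i\<close>, so
  well-founded recursion along \<open>k\<close> may choose a maximal antichain at each
  level.\<close>

lemma antichain_tree_exists: "\<exists>W. antichain_tree N W"
  unfolding antichain_tree_def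
proof (rule dependent_wf_choice[OF wf_k])
  fix f g :: "'k \<Rightarrow> (('i \<rightharpoonup> 'b) \<times> ('j \<rightharpoonup> 'c)) set" and x r
  assume "\<And>z. (z, x) \<in> k - Id \<Longrightarrow> f z = g z"
  then have "stage N f x = stage N g x"
    unfolding in_k_minus_Id stage_def by simp
  then show "(r \<subseteq> stage N f x \<and>
     (\<forall>v\<in>r. \<forall>w\<in>r. compat (snd v) (snd w) \<longrightarrow> v = w) \<and>
     (\<forall>p\<in>stage N f x. \<exists>w\<in>r. compat (snd p) (snd w))) =
    (r \<subseteq> stage N g x \<and>
     (\<forall>v\<in>r. \<forall>w\<in>r. compat (snd v) (snd w) \<longrightarrow> v = w) \<and>
     (\<forall>p\<in>stage N g x. \<exists>w\<in>r. compat (snd p) (snd w)))" by simp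
next
  fix x and f :: "'k \<Rightarrow> (('i \<rightharpoonup> 'b) \<times> ('j \<rightharpoonup> 'c)) set"
  let ?R = "\<lambda>p q :: ('i \<rightharpoonup> 'b) \<times> ('j \<rightharpoonup> 'c). compat (snd p) (snd q)"
  have R: "symp ?R" "reflp ?R"
    by (auto intro!: sympI reflpI compat_sym compat_refl)
  show "\<exists>r. r \<subseteq> stage N f x \<and>
     (\<forall>v\<in>r. \<forall>w\<in>r. compat (snd v) (snd w) \<longrightarrow> v = w) \<and>
     (\<forall>p\<in>stage N f x. \<exists>w\<in>r. compat (snd p) (snd w))"
    using maximal_independent_set[OF R, of "stage N f x"] .
qed

text \<open>For \<open>j\<close> below \<open>i\<close> in \<open>S\<close>, the node
  \<open>w i\<close> refines some node of level \<open>j\<close>. That node and \<open>w j\<close>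
  both have second components below \<open>s\<close>, so the antichain property identifies them.
  Hence the chosen nodes form a chain in both components and can be united.\<close>

lemma antichain_tree_branch:
  assumes W: "antichain_tree N W" and S: "S \<subseteq> Field k"
    and w: "\<And>i. i \<in> S \<Longrightarrow> w i \<in> W i" "\<And>i. i \<in> S \<Longrightarrow> snd (w i) \<subseteq>\<^sub>m s"
  shows "\<exists>u v. forces u v \<and> v \<subseteq>\<^sub>m s \<and> (\<forall>i\<in>S. fst (w i) \<subseteq>\<^sub>m u) \<and>
    ( |S| <o k \<longrightarrow> u \<in> conds I B k \<and> v \<in> conds J C k)"
proof -
  have ws: "w i \<in> stage N W i" if "i \<in> S" for i
    using antichain_treeD(1)[OF W] w(1)[OF that] by blast
  have mono: "fst (w j) \<subseteq>\<^sub>m fst (w i) \<and> snd (w j) \<subseteq>\<^sub>m snd (w i)"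
    if ij: "i \<in> S" "j \<in> S" "j \<in> underS k i" for i j
  proof -
    obtain z where z: "z \<in> W j" "fst z \<subseteq>\<^sub>m fst (w i)" "snd z \<subseteq>\<^sub>m snd (w i)"
      using ws[OF ij(1)] ij(3) unfolding stage_def by auto
    have "compat (snd z) (snd (w j))"
      using compat_map_le map_le_trans[OF z(3) w(2)[OF ij(1)]] w(2)[OF ij(2)] .
    then have "z = w j" using antichain_treeD(2)[OF W z(1) w(1)[OF ij(2)]] by simp
    then show ?thesis using z by simp
  qed
  \<comment> \<open>The empty pair keeps the family nonempty when \<open>S\<close> is empty, as
    \<open>forces_Union\<close> demands.\<close>
  let ?F = "insert (Map.empty, Map.empty) (w ` S)"
  have lin: "(fst p \<subseteq>\<^sub>m fst q \<and> snd p \<subseteq>\<^sub>m snd q) \<or> (fst q \<subseteq>\<^sub>m fst p \<and> snd q \<subseteq>\<^sub>m snd p)"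
    if pq: "p \<in> ?F" "q \<in> ?F" for p q
  proof (cases "p \<in> w ` S \<and> q \<in> w ` S")
    case True
    then obtain i j where ij: "i \<in> S" "p = w i" "j \<in> S" "q = w j" by blast
    have "i = j \<or> i \<in> underS k j \<or> j \<in> underS k i"
      using underS_total S ij(1,3) by blast
    then show ?thesis
      using mono[OF ij(1,3)] mono[OF ij(3,1)] ij(2,4) by (elim disjE) auto
  next
    case False
    then show ?thesis using pq by auto
  qed
  have coh1: "b = c" if pq: "p \<in> fst ` ?F" "q \<in> fst ` ?F" "p a = Some b" "q a = Some c" for p q a b c
  proof -
    obtain p' q' where "p' \<in> ?F" "q' \<in> ?F" "p = fst p'" "q = fst q'" using pq(1,2) by (elim imageE)
    then have "p \<subseteq>\<^sub>m q \<or> q \<subseteq>\<^sub>m p" using lin by blast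
    then show ?thesis using pq(3,4) by (auto simp: map_le_iff)
  qed
  have coh2: "b = c" if pq: "p \<in> snd ` ?F" "q \<in> snd ` ?F" "p a = Some b" "q a = Some c" for p q a b c
  proof -
    obtain p' q' where "p' \<in> ?F" "q' \<in> ?F" "p = snd p'" "q = snd q'" using pq(1,2) by (elim imageE)
    then have "p \<subseteq>\<^sub>m q \<or> q \<subseteq>\<^sub>m p" using lin by blast
    then show ?thesis using pq(3,4) by (auto simp: map_le_iff)
  qed
  obtain u where u: "\<And>a b. u a = Some b \<longleftrightarrow> (\<exists>p\<in>fst ` ?F. p a = Some b)"
    using coherent_union[of "fst ` ?F"] coh1 by blast
  obtain v where v: "\<And>a b. v a = Some b \<longleftrightarrow> (\<exists>p\<in>snd ` ?F. p a = Some b)"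
    using coherent_union[of "snd ` ?F"] coh2 by blast
  have Fst: "forces (fst p) (snd p) \<and> fst p \<in> conds I B k \<and> snd p \<in> conds J C k"
    if "p \<in> ?F" for p
    using that ws forces_empty conds_empty[of I B] conds_empty[of J C] by (auto simp: stage_def)
  have "forces u v"
  proof (rule forces_Union[of ?F])
    show "u a = Some b \<longleftrightarrow> (\<exists>p\<in>?F. fst p a = Some b)" for a b using u[of a b] by simp
    show "v a = Some b \<longleftrightarrow> (\<exists>p\<in>?F. snd p a = Some b)" for a b using v[of a b] by simp
  qed (use Fst in auto)
  moreover have "v \<subseteq>\<^sub>m s"
    using v w(2) by (auto simp: map_le_iff)
  moreover have "fst (w i) \<subseteq>\<^sub>m u" if "i \<in> S" for i
    using u that by (auto simp: map_le_iff)
  moreover have "u \<in> conds I B k \<and> v \<in> conds J C k" if "|S| <o k"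
  proof -
    have F: "|?F| <o k"
      using small_Un[OF small_finite[of "{(Map.empty, Map.empty)}"] small_image[OF that, of w]] by simp
    have "fst ` ?F \<subseteq> conds I B k" "snd ` ?F \<subseteq> conds J C k" using Fst by blast+
    then show ?thesis
      using conds_Union[OF small_image[OF F] _ u] conds_Union[OF small_image[OF F] _ v] by blast
  qed
  ultimately show ?thesis by (intro exI[of _ u] exI[of _ v]) simp
qed

text \<open>Induction on the level: the output conditions above nodes of an earlier level are dense,
  so distributivity gives \<open>q\<close> above nodes of all earlier levels. Their branch is lifted
  to \<open>q\<close>, made to avoid \<open>N i\<close>, and completed to a member of
  \<open>stage N W i\<close>; maximality then yields a compatible node.\<close>

lemma antichain_tree_predense:
  assumes W: "antichain_tree N W"
    and N: "\<And>i. i \<in> Field k \<Longrightarrow> nowhere_dense_in (box_topology I B k) (N i)"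
  shows "i \<in> Field k \<Longrightarrow> s \<in> conds J C k \<Longrightarrow> \<exists>w\<in>W i. compat (snd w) s"
proof (induction i arbitrary: s rule: wf_induct_rule[OF wf_k])
  case (1 i)
  define E where "E j = {q. \<exists>w\<in>W j. snd w \<subseteq>\<^sub>m q}" for j
  have dense: "\<exists>q\<in>conds J C k. p \<subseteq>\<^sub>m q \<and> q \<in> E j" if j: "j \<in> underS k i" and p: "p \<in> conds J C k" for j p
  proof -
    have "j \<in> Field k" "(j, i) \<in> k - Id" using j underS_subset in_k_minus_Id by auto
    then obtain w where w: "w \<in> W j" "compat (snd w) p" using 1(1) p by blast
    have "snd w \<in> conds J C k"
      using antichain_treeD(1)[OF W, of j] w(1) by (auto simp: stage_def)
    then show ?thesis
      using compat_add[OF w(2)] conds_add[OF _ p] w(1) unfolding E_def by blast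
  qed
  have upward: "q \<in> E j" if "p \<in> E j" "p \<subseteq>\<^sub>m q" for j p q
    using that map_le_trans unfolding E_def by blast
  have "\<exists>q\<in>conds J C k. s \<subseteq>\<^sub>m q \<and> (\<forall>j\<in>underS k i. q \<in> E j)"
    by (rule conds_distributive[OF 1(3)]) (fact dense, fact upward)
  then obtain q where q: "q \<in> conds J C k" "s \<subseteq>\<^sub>m q" "\<forall>j\<in>underS k i. q \<in> E j"
    by blast
  have "\<forall>j\<in>underS k i. \<exists>w. w \<in> W j \<and> snd w \<subseteq>\<^sub>m q" using q(3) unfolding E_def by blast
  then obtain w where w: "\<forall>j\<in>underS k i. w j \<in> W j \<and> snd (w j) \<subseteq>\<^sub>m q"
    by (rule bchoice[THEN exE])
  have "w j \<in> W j" "snd (w j) \<subseteq>\<^sub>m q" if "j \<in> underS k i" for j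
    using bspec[OF w that] by auto
  from antichain_tree_branch[OF W underS_subset[of i] this]
  obtain u v where uv: "forces u v" "v \<subseteq>\<^sub>m q" "\<forall>j\<in>underS k i. fst (w j) \<subseteq>\<^sub>m u" "u \<in> conds I B k"
    using small_underS[of i] by auto
  have "dom q \<subseteq> J" "ran q \<subseteq> C" using q(1) unfolding conds_def by auto
  from forces_lift[OF uv(1,2) this] obtain t where t: "u \<subseteq>\<^sub>m t" "forces t q" "t \<in> conds I B k"
    using uv(4) q(1) by metis
  obtain t1 where t1: "t1 \<in> conds I B k" "t \<subseteq>\<^sub>m t1" "basic_open I B t1 \<inter> N i = {}"
    using N[OF 1(2)] t(3) unfolding nowhere_dense_box_iff[OF B_ne] by blast
  \<comment> \<open>\<open>t1\<close> may touch rows outside \<open>dom q\<close>, so inputs and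
    outputs are extended together to restore \<open>forces\<close>.\<close>
  obtain t2 s2 where 2: "t2 \<in> conds I B k" "s2 \<in> conds J C k" "t1 \<subseteq>\<^sub>m t2" "q \<subseteq>\<^sub>m s2" "forces t2 s2"
    using forces_extend[OF t(2) q(1) t1(1,2)] .
  have "basic_open I B t2 \<inter> N i = {}"
    using t1(3) basic_open_antimono[OF 2(3), of I B] by blast
  moreover have "fst (w j) \<subseteq>\<^sub>m t2 \<and> snd (w j) \<subseteq>\<^sub>m s2 \<and> w j \<in> W j" if "j \<in> underS k i" for j
  proof -
    have "u \<subseteq>\<^sub>m t2" using t(1) t1(2) 2(3) map_le_trans by metis
    then show ?thesis
      using bspec[OF uv(3) that] bspec[OF w that] 2(4) map_le_trans by metis
  qed
  ultimately have "(t2, s2) \<in> stage N W i"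
    using 2 unfolding stage_def by auto
  from antichain_treeD(3)[OF W this] obtain z where z: "z \<in> W i" "compat s2 (snd z)"
    by auto
  have "compat s (snd z)" using compat_mono[OF z(2) map_le_trans[OF q(2) 2(4)]] .
  then show ?case using z(1) compat_sym by blast
qed

text \<open>The points missing level \<open>i\<close> form a nowhere dense set \<open>M i\<close>,
  as that level is predense. A point of \<open>A\<close> outside every \<open>M i\<close> would pick
  a node on each level, and the branch would give it a preimage outside all the sets covering the
  preimage of \<open>A\<close>.\<close>

lemma meagre_if_vimage_meagre:
  assumes A: "A \<subseteq> J \<rightarrow>\<^sub>E C"
    and vA: "{x \<in> I \<rightarrow>\<^sub>E B. \<phi> x \<in> A} \<in> meagre_ideal (box_topology I B k) k"
  shows "A \<in> meagre_ideal (box_topology J C k) k"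
proof -
  obtain F where F: "{x \<in> I \<rightarrow>\<^sub>E B. \<phi> x \<in> A} = \<Union>F" "|F| \<le>o k"
    "\<forall>N\<in>F. nowhere_dense_in (box_topology I B k) N"
    using vA unfolding meagre_ideal_def by auto
  have "\<exists>N. N ` Field k = F \<or> F = {}"
    using card_of_ordLeq2[of F "Field k"] ordLeq_ordIso_trans[OF F(2) ordIso_symmetric[OF card_of_Field_ordIso[OF card]]] by blast
  then obtain N0 where N0: "F = {} \<or> N0 ` Field k = F" by blast
  \<comment> \<open>\<open>Field k\<close> is nonempty, so an empty family cannot be enumerated by
    it; empty sets stand in.\<close>
  define N where "N i = (if F = {} then {} else N0 i)" for i
  have "nowhere_dense_in (box_topology I B k) {}" by (simp add: nowhere_dense_in_def)
  then have N: "nowhere_dense_in (box_topology I B k) (N i)" if "i \<in> Field k" for i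
    using F(3) N0 that unfolding N_def by auto
  have NF: "\<Union>F = (\<Union>i\<in>Field k. N i)" using N0 unfolding N_def by auto
  obtain W where W: "antichain_tree N W" using antichain_tree_exists by blast
  define M where "M i = {y \<in> J \<rightarrow>\<^sub>E C. \<forall>w\<in>W i. y \<notin> basic_open J C (snd w)}" for i
  have M: "nowhere_dense_in (box_topology J C k) (M i)" if i: "i \<in> Field k" for i
    unfolding nowhere_dense_box_iff[OF C_ne]
  proof (intro conjI ballI)
    show "M i \<subseteq> J \<rightarrow>\<^sub>E C" unfolding M_def by auto
    fix s assume s: "s \<in> conds J C k"
    obtain w where w: "w \<in> W i" "compat (snd w) s"
      using antichain_tree_predense[OF W N i s] by auto
    have "snd w \<in> conds J C k"
      using antichain_treeD(1)[OF W, of i] w(1) by (auto simp: stage_def)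
    moreover have "basic_open J C (snd w ++ s) \<inter> M i = {}"
      using basic_open_antimono[of "snd w" "snd w ++ s" J C] compat_add[OF w(2)] w(1)
      unfolding M_def by blast
    ultimately show "\<exists>s'\<in>conds J C k. s \<subseteq>\<^sub>m s' \<and> basic_open J C s' \<inter> M i = {}"
      using conds_add[OF _ s] compat_add[OF w(2)] by blast
  qed
  have "A \<subseteq> (\<Union>i\<in>Field k. M i)"
  proof
    fix y assume y: "y \<in> A"
    show "y \<in> (\<Union>i\<in>Field k. M i)"
    proof (rule ccontr)
      assume n: "y \<notin> (\<Union>i\<in>Field k. M i)"
      have yJ: "y \<in> J \<rightarrow>\<^sub>E C" using y A by blast
      define s where "s \<alpha> = (if \<alpha> \<in> J then Some (y \<alpha>) else None)" for \<alpha>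
      have ds: "dom s \<subseteq> J" "ran s \<subseteq> C" using yJ unfolding s_def
        by (auto simp: ran_def split: if_splits)
      have "\<forall>i\<in>Field k. \<exists>w. w \<in> W i \<and> y \<in> basic_open J C (snd w)"
        using n yJ unfolding M_def by blast
      then obtain w where w: "\<forall>i\<in>Field k. w i \<in> W i \<and> y \<in> basic_open J C (snd (w i))"
        by (rule bchoice[THEN exE])
      have ws: "snd (w i) \<subseteq>\<^sub>m s" if i: "i \<in> Field k" for i
      proof -
        have "w i \<in> stage N W i"
          using antichain_treeD(1)[OF W, of i] bspec[OF w i] by blast
        then have "dom (snd (w i)) \<subseteq> J" by (simp add: stage_def conds_def)
        moreover have "y \<in> basic_open J C (snd (w i))" using bspec[OF w i] by simp
        ultimately show ?thesis unfolding map_le_iff s_def basic_open_iff by auto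
      qed
      have wW: "w i \<in> W i" if "i \<in> Field k" for i using bspec[OF w that] by simp
      from antichain_tree_branch[OF W subset_refl wW ws]
      obtain u v where uv: "forces u v" "v \<subseteq>\<^sub>m s" "\<forall>i\<in>Field k. fst (w i) \<subseteq>\<^sub>m u" by auto
      \<comment> \<open>The branch need not exhaust \<open>s\<close>, the total map given by
        \<open>y\<close>. Lifting fixes the remaining rows, so every point of
        \<open>basic_open I B t\<close> is mapped to \<open>y\<close>.\<close>
      obtain t where t: "u \<subseteq>\<^sub>m t" "forces t s"
        using forces_lift[OF uv(1,2) ds] by metis
      have t': "dom t \<subseteq> I" "ran t \<subseteq> B" "\<phi> ` basic_open I B t \<subseteq> basic_open J C s"
        using t(2) unfolding forces_def by auto
      obtain x where x: "x \<in> basic_open I B t"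
        using basic_open_nonempty[OF t'(1,2) B_ne] .
      have "x \<notin> N i" if i: "i \<in> Field k" for i
      proof -
        have "x \<in> basic_open I B (fst (w i))"
          using x basic_open_antimono[OF map_le_trans[OF bspec[OF uv(3) i] t(1)], of I B] by blast
        moreover have "w i \<in> stage N W i"
          using antichain_treeD(1)[OF W, of i] bspec[OF w i] by blast
        ultimately show ?thesis unfolding stage_def by blast
      qed
      moreover have "\<phi> x = y"
      proof -
        have "\<phi> x \<in> basic_open J C s" using t'(3) x by blast
        then have "\<phi> x \<in> J \<rightarrow>\<^sub>E C" "\<And>\<alpha>. \<alpha> \<in> J \<Longrightarrow> \<phi> x \<alpha> = y \<alpha>"
          unfolding basic_open_iff s_def by auto
        then show ?thesis using yJ by (intro PiE_ext) auto
      qed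
      moreover have "x \<in> I \<rightarrow>\<^sub>E B" using x by (simp add: basic_open_iff)
      ultimately show False using y F(1) NF by blast
    qed
  qed
  moreover have "(\<Union>i\<in>Field k. M i) \<in> meagre_ideal (box_topology J C k) k"
  proof -
    have "|M ` Field k| \<le>o k"
      using card_of_image[of M "Field k"] ordLeq_ordIso_trans[OF _ card_of_Field_ordIso[OF card]] by blast
    then show ?thesis unfolding meagre_ideal_def using M by blast
  qed
  ultimately show ?thesis using meagre_ideal_subset by blast
qed

end

section \<open>Transport of witnesses\<close>

text \<open>To be read as an inequality in reverse order: the least size for \<open>Q\<close> is at
  most that for \<open>P\<close>.\<close>

definition witness_dominated :: "('a set \<Rightarrow> bool) \<Rightarrow> ('b set \<Rightarrow> bool) \<Rightarrow> bool" where
  "witness_dominated P Q \<longleftrightarrow> (\<forall>A. P A \<longrightarrow> (\<exists>B. Q B \<and> |B| \<le>o |A| ))"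

lemma same_least_size_iff:
  "same_least_size P Q \<longleftrightarrow> witness_dominated P Q \<and> witness_dominated Q P"
  unfolding same_least_size_def witness_dominated_def by blast

text \<open>Families in \<open>MY\<close> are pulled back for cov and add, and a set outside
  \<open>MX\<close> is pushed forward for non. Passing from \<open>MX\<close> to \<open>MY\<close>
  by \<open>iff\<close> keeps the union outside the ideal for add, and puts the sets built for cof
  into \<open>MY\<close>.\<close>

lemma vimage_reflecting_witnesses:
  fixes \<phi> :: "'a \<Rightarrow> 'b"
  assumes into: "\<And>x. x \<in> X \<Longrightarrow> \<phi> x \<in> Y"
    and MY: "\<And>A. A \<in> MY \<Longrightarrow> A \<subseteq> Y"
    and down: "\<And>A A'. A \<in> MX \<Longrightarrow> A' \<subseteq> A \<Longrightarrow> A' \<in> MX"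
    and iff: "\<And>A. A \<subseteq> Y \<Longrightarrow> {x \<in> X. \<phi> x \<in> A} \<in> MX \<longleftrightarrow> A \<in> MY"
  shows "witness_dominated (cov_witness Y MY) (cov_witness X MX)"
    and "witness_dominated (add_witness MY) (add_witness MX)"
    and "witness_dominated (non_witness X MX) (non_witness Y MY)"
    and "witness_dominated (cof_witness MX) (cof_witness MY)"
proof -
  let ?g = "\<lambda>A. {x \<in> X. \<phi> x \<in> A}"
  have gM: "?g A \<in> MX" if "A \<in> MY" for A using iff[OF MY[OF that]] that by simp
  have gU: "\<Union>(?g ` C) = ?g (\<Union>C)" for C by auto
  show "witness_dominated (cov_witness Y MY) (cov_witness X MX)"
    unfolding witness_dominated_def
  proof (intro allI impI)
    fix C assume C: "cov_witness Y MY C"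
    have "?g ` C \<subseteq> MX" using C gM unfolding cov_witness_def by blast
    moreover have "\<Union>(?g ` C) = X" unfolding gU using C into unfolding cov_witness_def by auto
    ultimately have "cov_witness X MX (?g ` C)" unfolding cov_witness_def by simp
    then show "\<exists>B. cov_witness X MX B \<and> |B| \<le>o |C|" using card_of_image[of ?g C] by blast
  qed
  show "witness_dominated (add_witness MY) (add_witness MX)"
    unfolding witness_dominated_def
  proof (intro allI impI)
    fix C assume C: "add_witness MY C"
    have sub: "C \<subseteq> MY" and un: "\<Union>C \<notin> MY" using C unfolding add_witness_def by auto
    have "?g ` C \<subseteq> MX" using sub gM by blast
    moreover have "\<Union>C \<subseteq> Y" using sub MY by blast
    then have "\<Union>(?g ` C) \<notin> MX" unfolding gU using iff[of "\<Union>C"] un by blast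
    ultimately have "add_witness MX (?g ` C)" unfolding add_witness_def by simp
    then show "\<exists>B. add_witness MX B \<and> |B| \<le>o |C|" using card_of_image[of ?g C] by blast
  qed
  show "witness_dominated (non_witness X MX) (non_witness Y MY)"
    unfolding witness_dominated_def
  proof (intro allI impI)
    fix N assume N: "non_witness X MX N"
    have NX: "N \<subseteq> X" "N \<notin> MX" using N unfolding non_witness_def by auto
    have "N \<subseteq> ?g (\<phi> ` N)" using NX by auto
    then have "\<phi> ` N \<notin> MY" using gM down NX(2) by blast
    moreover have "\<phi> ` N \<subseteq> Y" using NX(1) into by blast
    ultimately have "non_witness Y MY (\<phi> ` N)" unfolding non_witness_def by simp
    then show "\<exists>B. non_witness Y MY B \<and> |B| \<le>o |N|" using card_of_image[of \<phi> N] by blast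
  qed
  show "witness_dominated (cof_witness MX) (cof_witness MY)"
    unfolding witness_dominated_def
  proof (intro allI impI)
    fix F assume F: "cof_witness MX F"
    \<comment> \<open>\<open>?h J\<close> is the largest subset of \<open>Y\<close> whose preimage
      is contained in \<open>J\<close>.\<close>
    let ?h = "\<lambda>J. {y \<in> Y. \<forall>x\<in>X. \<phi> x = y \<longrightarrow> x \<in> J}"
    have "?h J \<in> MY" if J: "J \<in> F" for J
    proof -
      have "J \<in> MX" using F J unfolding cof_witness_def by blast
      moreover have "?g (?h J) \<subseteq> J" by auto
      ultimately have "?g (?h J) \<in> MX" by (rule down)
      moreover have "?h J \<subseteq> Y" by auto
      ultimately show ?thesis using iff[of "?h J"] by simp
    qed
    moreover have "\<exists>J\<in>?h ` F. A \<subseteq> J" if A: "A \<in> MY" for A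
    proof -
      obtain J where J: "J \<in> F" "?g A \<subseteq> J" using gM[OF A] F unfolding cof_witness_def by blast
      then have "A \<subseteq> ?h J" using MY[OF A] by auto
      then show ?thesis using J(1) by blast
    qed
    ultimately have "cof_witness MY (?h ` F)" unfolding cof_witness_def by blast
    then show "\<exists>B. cof_witness MY B \<and> |B| \<le>o |F|" using card_of_image[of ?h F] by blast
  qed
qed

lemma (in row_map) witnesses:
  defines "TX \<equiv> box_topology I B k" and "TY \<equiv> box_topology J C k"
  shows "witness_dominated (cov_witness (topspace TY) (meagre_ideal TY k))
           (cov_witness (topspace TX) (meagre_ideal TX k))"
    and "witness_dominated (add_witness (meagre_ideal TY k)) (add_witness (meagre_ideal TX k))"
    and "witness_dominated (non_witness (topspace TX) (meagre_ideal TX k))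
           (non_witness (topspace TY) (meagre_ideal TY k))"
    and "witness_dominated (cof_witness (meagre_ideal TX k)) (cof_witness (meagre_ideal TY k))"
proof -
  have into: "\<phi> x \<in> topspace TY" if "x \<in> topspace TX" for x
    using map_into that unfolding TX_def TY_def topspace_box .
  have MY: "A \<subseteq> topspace TY" if "A \<in> meagre_ideal TY k" for A
    using that unfolding meagre_ideal_def nowhere_dense_in_def by auto
  have iff: "{x \<in> topspace TX. \<phi> x \<in> A} \<in> meagre_ideal TX k \<longleftrightarrow> A \<in> meagre_ideal TY k"
    if "A \<subseteq> topspace TY" for A
    using meagre_vimage meagre_if_vimage_meagre that unfolding TX_def TY_def topspace_box by blast
  note R = vimage_reflecting_witnesses[of "topspace TX" \<phi> "topspace TY" "meagre_ideal TY k"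
      "meagre_ideal TX k", OF into MY meagre_ideal_subset iff]
  show "witness_dominated (cov_witness (topspace TY) (meagre_ideal TY k))
           (cov_witness (topspace TX) (meagre_ideal TX k))" by (rule R(1))
  show "witness_dominated (add_witness (meagre_ideal TY k)) (add_witness (meagre_ideal TX k))"
    by (rule R(2))
  show "witness_dominated (non_witness (topspace TX) (meagre_ideal TX k))
           (non_witness (topspace TY) (meagre_ideal TY k))" by (rule R(3))
  show "witness_dominated (cof_witness (meagre_ideal TX k)) (cof_witness (meagre_ideal TY k))"
    by (rule R(4))
qed

section \<open>The two maps\<close>

context regular_cardinal
begin

section \<open>Reading a row as the position of its first true entry\<close>

definition first_true :: "('k \<Rightarrow> bool) \<Rightarrow> 'k \<Rightarrow> bool" where
  "first_true z \<beta> \<longleftrightarrow> \<beta> \<in> Field k \<and> z \<beta> \<and> (\<forall>\<gamma>\<in>underS k \<beta>. \<not> z \<gamma>)"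

lemma first_true_unique:
  assumes "first_true z \<beta>" "first_true z \<gamma>"
  shows "\<beta> = \<gamma>"
  using assms underS_total[of \<beta> \<gamma>] unfolding first_true_def by blast

text \<open>A row without a true entry on \<open>Field k\<close> gets a default value, chosen in
  \<open>Field k\<close> so that \<open>decode_in\<close> holds without exception.\<close>

definition decode :: "('k \<Rightarrow> bool) \<Rightarrow> 'k" where
  "decode z = (if \<exists>\<beta>. first_true z \<beta> then THE \<beta>. first_true z \<beta> else SOME \<beta>. \<beta> \<in> Field k)"

lemma decode_eq: "first_true z \<beta> \<Longrightarrow> decode z = \<beta>"
  unfolding decode_def using first_true_unique by auto

lemma Field_ne: "Field k \<noteq> {}"
  using infinite_k by auto

lemma decode_in: "decode z \<in> Field k"
proof (cases "\<exists>\<beta>. first_true z \<beta>")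
  case True
  then show ?thesis using decode_eq unfolding first_true_def by metis
next
  case False
  then have "decode z = (SOME \<beta>. \<beta> \<in> Field k)" unfolding decode_def by auto
  then show ?thesis using Field_ne by (simp add: some_in_eq)
qed

text \<open>\<open>e\<close> arranges the coordinates into rows of length \<open>k\<close>. A small
  condition leaves some place in each row not set to false, and making the least such place true
  decides the row. Falsehood below \<open>c\<close> and truth at \<open>c\<close> realise the value
  \<open>c\<close>.\<close>

lemma row_map_decode:
  fixes e :: "'m \<times> 'k \<Rightarrow> 'm" and M :: "'m set"
  assumes e: "bij_betw e (M \<times> Field k) M"
  shows "row_map k M (UNIV :: bool set) M (Field k)
    (\<lambda>x. \<lambda>\<alpha>\<in>M. decode (\<lambda>\<beta>. x (e (\<alpha>, \<beta>)))) (\<lambda>i. fst (the_inv_into (M \<times> Field k) e i))"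
proof -
  define \<pi> where "\<pi> = the_inv_into (M \<times> Field k) e"
  have \<pi>e: "\<pi> (e (\<alpha>, \<beta>)) = (\<alpha>, \<beta>)" if "\<alpha> \<in> M" "\<beta> \<in> Field k" for \<alpha> \<beta>
    unfolding \<pi>_def using that e by (intro the_inv_into_f_f) (auto simp: bij_betw_def)
  have e\<pi>: "e (\<pi> i) = i" "\<pi> i \<in> M \<times> Field k" if "i \<in> M" for i
  proof -
    show "e (\<pi> i) = i" using that e f_the_inv_into_f_bij_betw unfolding \<pi>_def by metis
    show "\<pi> i \<in> M \<times> Field k"
      using the_inv_into_into[of e "M \<times> Field k" i] that e unfolding \<pi>_def bij_betw_def by auto
  qed
  have eM: "e (\<alpha>, \<beta>) \<in> M" if "\<alpha> \<in> M" "\<beta> \<in> Field k" for \<alpha> \<beta>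
    using e that unfolding bij_betw_def by auto
  have und: "\<gamma> \<in> Field k" if "\<gamma> \<in> underS k \<beta>" for \<beta> \<gamma>
    using that unfolding underS_def Field_def by auto
  show ?thesis unfolding \<pi>_def[symmetric]
  proof unfold_locales
    show "(\<lambda>\<alpha>\<in>M. decode (\<lambda>\<beta>. x (e (\<alpha>, \<beta>)))) \<in> M \<rightarrow>\<^sub>E Field k" for x
      using decode_in by auto
    show "fst (\<pi> i) \<in> M" if "i \<in> M" for i using e\<pi>(2)[OF that] by auto
  next
    fix \<alpha> and t :: "'m \<rightharpoonup> bool"
    assume \<alpha>: "\<alpha> \<in> M" and t: "t \<in> conds M UNIV k"
    \<comment> \<open>Places not already made false by \<open>t\<close>. The least of them is
      undefined or already true in \<open>t\<close>, so making it true extends \<open>t\<close>, and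
      all earlier places of the row are false.\<close>
    define Q where "Q = {\<beta> \<in> Field k. t (e (\<alpha>, \<beta>)) \<noteq> Some False}"
    have "Q \<noteq> {}"
    proof
      assume "Q = {}"
      then have "Field k \<subseteq> (\<lambda>i. snd (\<pi> i)) ` dom t"
        using \<pi>e[OF \<alpha>] unfolding Q_def by (force intro: rev_image_eqI)
      moreover have "|(\<lambda>i. snd (\<pi> i)) ` dom t| <o k"
        using t small_image unfolding conds_def by auto
      ultimately have "|Field k| <o k" using small_subset by blast
      then show False using card_of_Field_ordIso[OF card] not_ordLess_ordIso by blast
    qed
    then obtain \<beta> where \<beta>: "\<beta> \<in> Q" "\<And>\<gamma>. (\<gamma>, \<beta>) \<in> k - Id \<Longrightarrow> \<gamma> \<notin> Q"
      using wfE_min[OF wf_k] by (metis ex_in_conv)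
    define t' where "t' = t(e (\<alpha>, \<beta>) \<mapsto> True)"
    have \<beta>k: "\<beta> \<in> Field k" and tb: "t (e (\<alpha>, \<beta>)) \<noteq> Some False" using \<beta>(1) unfolding Q_def by auto
    have "t' \<in> conds M UNIV k"
      using t eM[OF \<alpha> \<beta>k] small_Un[OF small_finite[of "{e (\<alpha>, \<beta>)}"], of "dom t"]
      unfolding conds_def t'_def by auto
    moreover have "t \<subseteq>\<^sub>m t'" using tb unfolding t'_def map_le_iff by auto
    moreover have "\<forall>i\<in>dom t' - dom t. fst (\<pi> i) = \<alpha>"
      unfolding t'_def using \<pi>e[OF \<alpha> \<beta>k] by auto
    moreover have "(\<lambda>\<alpha>\<in>M. decode (\<lambda>\<beta>. x (e (\<alpha>, \<beta>)))) \<alpha> = \<beta>" if x: "x \<in> basic_open M UNIV t'" for x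
    proof -
      have "x (e (\<alpha>, \<beta>))" using x unfolding basic_open_iff t'_def by auto
      moreover have "\<not> x (e (\<alpha>, \<gamma>))" if g: "\<gamma> \<in> underS k \<beta>" for \<gamma>
      proof -
        have "\<gamma> \<notin> Q" using \<beta>(2) g in_k_minus_Id by blast
        then have "t (e (\<alpha>, \<gamma>)) = Some False" using und[OF g] unfolding Q_def by simp
        then have "t' (e (\<alpha>, \<gamma>)) = Some False" using \<open>t \<subseteq>\<^sub>m t'\<close> unfolding map_le_iff by simp
        then show ?thesis using x unfolding basic_open_iff by auto
      qed
      ultimately have "first_true (\<lambda>\<beta>. x (e (\<alpha>, \<beta>))) \<beta>" using \<beta>k unfolding first_true_def by simp
      then show ?thesis using decode_eq \<alpha> by simp
    qed
    ultimately show "\<exists>t'\<in>conds M UNIV k. \<exists>c\<in>Field k. t \<subseteq>\<^sub>m t' \<and>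
        (\<forall>i\<in>dom t' - dom t. fst (\<pi> i) = \<alpha>) \<and>
        (\<forall>x\<in>basic_open M UNIV t'. (\<lambda>\<alpha>\<in>M. decode (\<lambda>\<beta>. x (e (\<alpha>, \<beta>)))) \<alpha> = c)"
      using \<beta>k by (intro bexI[of _ t'] bexI[of _ \<beta>] conjI) simp_all
  next
    fix \<alpha> c assume \<alpha>: "\<alpha> \<in> M" and c: "c \<in> Field k"
    define p where "p i = (if i \<in> (\<lambda>\<beta>. e (\<alpha>, \<beta>)) ` insert c (underS k c)
      then Some (i = e (\<alpha>, c)) else None)" for i
    have dp: "dom p = (\<lambda>\<beta>. e (\<alpha>, \<beta>)) ` insert c (underS k c)" unfolding p_def by (auto simp: dom_def)
    have "|insert c (underS k c)| <o k"
      using small_Un[OF small_finite[of "{c}"] small_underS[of c]] by simp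
    then have "|dom p| <o k" unfolding dp by (rule small_image)
    moreover have "dom p \<subseteq> M" unfolding dp using eM[OF \<alpha>] c und by blast
    ultimately have "p \<in> conds M UNIV k" by (simp add: condsI)
    moreover have "\<forall>i\<in>dom p. fst (\<pi> i) = \<alpha>"
      unfolding dp using \<pi>e[OF \<alpha>] c und by auto
    moreover have "(\<lambda>\<alpha>\<in>M. decode (\<lambda>\<beta>. x (e (\<alpha>, \<beta>)))) \<alpha> = c" if x: "x \<in> basic_open M UNIV p" for x
    proof -
      have xi: "x i = b" if "p i = Some b" for i b using x that unfolding basic_open_iff by blast
      have "x (e (\<alpha>, c))" using xi[of "e (\<alpha>, c)" True] unfolding p_def by simp
      moreover have "\<not> x (e (\<alpha>, \<gamma>))" if g: "\<gamma> \<in> underS k c" for \<gamma>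
      proof -
        have "\<gamma> \<noteq> c" using g unfolding underS_def by simp
        then have "e (\<alpha>, \<gamma>) \<noteq> e (\<alpha>, c)" using \<pi>e[OF \<alpha> und[OF g]] \<pi>e[OF \<alpha> c] by auto
        then show ?thesis using xi[of "e (\<alpha>, \<gamma>)" False] g unfolding p_def by auto
      qed
      ultimately have "first_true (\<lambda>\<beta>. x (e (\<alpha>, \<beta>))) c" using c unfolding first_true_def by simp
      then show ?thesis using decode_eq \<alpha> by simp
    qed
    ultimately show "\<exists>p\<in>conds M UNIV k. (\<forall>i\<in>dom p. fst (\<pi> i) = \<alpha>) \<and>
        (\<forall>x\<in>basic_open M UNIV p. (\<lambda>\<alpha>\<in>M. decode (\<lambda>\<beta>. x (e (\<alpha>, \<beta>)))) \<alpha> = c)"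
      by (intro bexI[of _ p] conjI) simp_all
  qed (use Field_ne in auto)
qed

text \<open>Each row is a single coordinate, decided as soon as its value is fixed: \<open>r\<close>
  gives true, any other value gives false. Another value exists because \<open>Field k\<close> is
  infinite.\<close>

lemma row_map_test:
  fixes M :: "'m set"
  assumes r: "r \<in> Field k"
  shows "row_map k M (Field k) M (UNIV :: bool set) (\<lambda>x. \<lambda>\<alpha>\<in>M. x \<alpha> = r) (\<lambda>i. i)"
proof unfold_locales
  fix \<alpha> and t :: "'m \<rightharpoonup> 'k"
  assume \<alpha>: "\<alpha> \<in> M" and t: "t \<in> conds M (Field k) k"
  \<comment> \<open>An existing value at \<open>\<alpha>\<close> is kept; otherwise \<open>r\<close>
    serves as an arbitrary choice.\<close>
  define b where "b = (case t \<alpha> of None \<Rightarrow> r | Some b \<Rightarrow> b)"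
  define t' where "t' = t(\<alpha> \<mapsto> b)"
  have "b \<in> Field k" using t r unfolding b_def conds_def by (auto split: option.splits intro: ranI)
  then have "t' \<in> conds M (Field k) k"
    using t \<alpha> small_Un[OF small_finite[of "{\<alpha>}"], of "dom t"]
    unfolding conds_def t'_def by (auto simp: ran_def)
  moreover have "t \<subseteq>\<^sub>m t'" unfolding t'_def b_def map_le_iff by (auto split: option.splits)
  moreover have "(\<lambda>\<alpha>\<in>M. x \<alpha> = r) \<alpha> = (b = r)" if "x \<in> basic_open M (Field k) t'" for x
    using that \<alpha> unfolding basic_open_iff t'_def by auto
  ultimately show "\<exists>t'\<in>conds M (Field k) k. \<exists>c\<in>UNIV. t \<subseteq>\<^sub>m t' \<and> (\<forall>i\<in>dom t' - dom t. i = \<alpha>) \<and>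
      (\<forall>x\<in>basic_open M (Field k) t'. (\<lambda>\<alpha>\<in>M. x \<alpha> = r) \<alpha> = c)"
    by (intro bexI[of _ t'] bexI[of _ "b = r"]) (auto simp: t'_def split: if_splits)
next
  fix \<alpha> and c :: bool assume \<alpha>: "\<alpha> \<in> M"
  have "infinite (Field k - {r})" using infinite_k by simp
  then obtain r' where r': "r' \<in> Field k" "r' \<noteq> r" by (metis Diff_iff ex_in_conv finite.emptyI insertI1)
  define b where "b = (if c then r else r')"
  have "[\<alpha> \<mapsto> b] \<in> conds M (Field k) k"
    using \<alpha> r r' small_finite[of "{\<alpha>}"] unfolding conds_def b_def by auto
  moreover have "(\<lambda>\<alpha>\<in>M. x \<alpha> = r) \<alpha> = c" if "x \<in> basic_open M (Field k) [\<alpha> \<mapsto> b]" for x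
    using that \<alpha> r' unfolding basic_open_iff b_def by (auto split: if_splits)
  ultimately show "\<exists>p\<in>conds M (Field k) k. (\<forall>i\<in>dom p. i = \<alpha>) \<and>
      (\<forall>x\<in>basic_open M (Field k) p. (\<lambda>\<alpha>\<in>M. x \<alpha> = r) \<alpha> = c)"
    by (intro bexI[of _ "[\<alpha> \<mapsto> b]"]) auto
qed (use Field_ne in auto)

end

theorem mainTheorem9:
  fixes k :: "'k rel" and m :: "'m rel"
  assumes "Card_order k" and "Cinfinite k" and "regularCard k"
    and "Card_order m" and "\<not> regularCard m"
    and "\<exists>C\<subseteq>Field m. cofinal C m \<and> |C| =o k"
    and "\<forall>C\<subseteq>Field m. cofinal C m \<longrightarrow> k \<le>o |C|"
  defines "T2 \<equiv> box_topology (Field m) (UNIV :: bool set) k"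
    and "Tk \<equiv> box_topology (Field m) (Field k) k"
  shows "same_least_size (cov_witness (topspace T2) (meagre_ideal T2 k))
                         (cov_witness (topspace Tk) (meagre_ideal Tk k)) \<and>
          same_least_size (add_witness (meagre_ideal T2 k)) (add_witness (meagre_ideal Tk k)) \<and>
          same_least_size (non_witness (topspace T2) (meagre_ideal T2 k))
                         (non_witness (topspace Tk) (meagre_ideal Tk k)) \<and>
          same_least_size (cof_witness (meagre_ideal T2 k)) (cof_witness (meagre_ideal Tk k))"
proof -
  interpret regular_cardinal k using assms(1-3) by unfold_locales
  \<comment> \<open>The cofinal set bounds \<open>k\<close> by the size of \<open>Field m\<close>,
    so that \<open>Field m\<close> can be split into as many rows of length \<open>k\<close> as it
    has elements.\<close>
  obtain C where C: "C \<subseteq> Field m" "|C| =o k" using assms(6) by blast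
  have "|Field k| =o k" using card_of_Field_ordIso[OF card] .
  then have "|Field k| =o |C|" using C(2) ordIso_symmetric ordIso_transitive by blast
  then have le: "|Field k| \<le>o |Field m|"
    using card_of_mono1[OF C(1)] ordIso_ordLeq_trans by blast
  then have "infinite (Field m)" using infinite_k card_of_ordLeq_finite by blast
  then have "|Field m \<times> Field k| =o |Field m|"
    using card_of_Times_infinite[OF _ Field_ne le] by blast
  then obtain e where e: "bij_betw e (Field m \<times> Field k) (Field m)"
    using card_of_ordIso by blast
  obtain r where r: "r \<in> Field k" using Field_ne by blast
  \<comment> \<open>For each invariant, \<open>row_map_decode\<close> gives one direction and
    \<open>row_map_test\<close> the other.\<close>
  show ?thesis
    unfolding same_least_size_iff T2_def Tk_def
    using row_map.witnesses[OF row_map_decode[OF e]]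
      row_map.witnesses[OF row_map_test[OF r, of "Field m"]] by simp
qed

end
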